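(* Let $(X,d)$ be a complete metric space, let $\alpha\in[0,1)$, and let $\psi\colon[0,\infty)\to[0,\infty)$ be a function that is continuous at $0$, with $\psi(0)=0$, and such that for some $c>0$ and $\gamma>0$ we have $\psi(t)\ge c\,t^\gamma$ for all $t\ge0$. Let $T\colon X\to X$ be a mapping satisfying $$d(Tx,Ty)\,\psi(d(Tx,Ty))\le\alpha\,d(x,y)\,\psi(d(x,y))\quad\text{for all }x,y\in X.$$ Then $T$ is a Picard operator on $(X,d)$.
   Context: $X$ is a nonempty set. A self-mapping $T$ of a metric space $(X,d)$ is called a Picard operator if $T$ has a unique fixed point $u\in X$ and for every $x\in X$ the sequence of iterates $(T^n x)$ converges to $u$ in $(X,d)$. *)

theory Defs
  imports "HOL-Analysis.Abstract_Metric_Spaces"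
begin

definition (in Metric_space) picard_operator :: "('a \<Rightarrow> 'a) \<Rightarrow> bool" where
  "picard_operator T \<longleftrightarrow>
     T \<in> M \<rightarrow> M \<and>
     (\<exists>u. u \<in> M \<and> T u = u \<and> (\<forall>v\<in>M. T v = v \<longrightarrow> v = u) \<and>
          (\<forall>x\<in>M. limitin mtopology (\<lambda>n. (T ^^ n) x) u sequentially))"

end

theory Submission imports Defs begin

text \<open>Put \<open>\<rho> t = t * \<psi> t\<close>. Iterating the contraction condition gives
  \<open>\<rho> (d (T\<^sup>n x) (T\<^sup>n y)) \<le> \<alpha>\<^sup>n * \<rho> (d x y)\<close>, and \<open>\<rho> t \<ge> c * t powr (1 + \<gamma>)\<close> turns this
  into geometric decay of \<open>d (T\<^sup>n x) (T\<^sup>n y)\<close> with ratio \<open>\<alpha> powr (1 / (1 + \<gamma>))\<close>. Hence all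
  orbits are Cauchy and pairwise asymptotic; continuity of \<open>\<psi>\<close> at \<open>0\<close> makes \<open>T\<close>
  continuous, so their common limit is a fixed point.\<close>

lemma power_powr_commute:
  fixes a e :: real
  assumes "a \<ge> 0"
  shows "(a ^ n) powr e = (a powr e) ^ n"
  using assms by (induction n) (simp_all add: powr_mult)

lemma le_powr_inverse_if_powr_le:
  fixes t B e :: real
  assumes "t \<ge> 0" "e > 0" "t powr e \<le> B"
  shows "t \<le> B powr (1 / e)"
proof -
  have "(t powr e) powr (1 / e) \<le> B powr (1 / e)"
    using assms by (intro powr_mono2) auto
  then show ?thesis
    using assms by (simp add: powr_powr)
qed

context Metric_space
begin

text \<open>By the triangle inequality, distances along the sequence are dominated by pieces of a
  convergent geometric series, whose tails tend to 0.\<close>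

lemma MCauchy_if_geometric_steps:
  assumes "range \<sigma> \<subseteq> M" "0 \<le> q" "q < 1"
    and step: "\<And>n. d (\<sigma> n) (\<sigma> (Suc n)) \<le> K * q ^ n"
  shows "MCauchy \<sigma>"
proof -
  have in_M: "\<sigma> n \<in> M" for n
    using assms(1) by auto
  have K: "K \<ge> 0"
    using order_trans[OF nonneg step[of 0]] by simp
  \<comment> \<open>The right-hand side is the closed form of
    \<open>K * (q ^ n + ... + q ^ (n + k - 1))\<close>; keeping the subtracted term lets the
    induction close with an equality.\<close>
  have bound: "d (\<sigma> n) (\<sigma> (n + k)) \<le> K / (1 - q) * (q ^ n - q ^ (n + k))" for n k
  proof (induction k)
    case 0
    then show ?case using in_M by simp
  next
    case (Suc k)
    have "d (\<sigma> n) (\<sigma> (n + Suc k)) \<le> d (\<sigma> n) (\<sigma> (n + k)) + d (\<sigma> (n + k)) (\<sigma> (Suc (n + k)))"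
      using triangle in_M by simp
    also have "\<dots> \<le> K / (1 - q) * (q ^ n - q ^ (n + k)) + K * q ^ (n + k)"
      using Suc step by (intro add_mono)
    also have "\<dots> = K / (1 - q) * (q ^ n - q ^ (n + Suc k))"
      using \<open>q < 1\<close> by (simp add: field_simps)
    finally show ?case .
  qed
  have tail: "d (\<sigma> n) (\<sigma> m) \<le> K / (1 - q) * q ^ n" if "n \<le> m" for n m
  proof -
    have "d (\<sigma> n) (\<sigma> m) \<le> K / (1 - q) * (q ^ n - q ^ m)"
      using bound[of n "m - n"] that by simp
    also have "\<dots> \<le> K / (1 - q) * q ^ n"
      using K assms by (intro mult_left_mono) auto
    finally show ?thesis .
  qed
  show ?thesis
    unfolding MCauchy_def
  proof (intro conjI allI impI)
    fix \<epsilon> :: real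
    assume "\<epsilon> > 0"
    have "(\<lambda>n. K / (1 - q) * q ^ n) \<longlonglongrightarrow> 0"
      using assms by (intro tendsto_mult_right_zero LIMSEQ_realpow_zero)
    then have "\<forall>\<^sub>F n in sequentially. K / (1 - q) * q ^ n < \<epsilon>"
      using \<open>\<epsilon> > 0\<close> by (rule order_tendstoD)
    then obtain N where N: "\<And>n. n \<ge> N \<Longrightarrow> K / (1 - q) * q ^ n < \<epsilon>"
      by (auto simp: eventually_sequentially)
    have "d (\<sigma> n) (\<sigma> n') < \<epsilon>" if "N \<le> n" "N \<le> n'" for n n'
      using that
    proof (induction n n' rule: linorder_wlog)
      case (le a b)
      then show ?case using tail[of a b] N[of a] by linarith
    next
      case (sym a b)
      then show ?case by (simp add: commute)
    qed
    then show "\<exists>N. \<forall>n n'. N \<le> n \<longrightarrow> N \<le> n' \<longrightarrow> d (\<sigma> n) (\<sigma> n') < \<epsilon>"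
      by blast
  qed (use assms(1) in auto)
qed

text \<open>Working with a general \<open>\<rho>\<close> separates the argument from the product
  form \<open>t * \<psi> t\<close>. Since \<open>\<rho>\<close> may fail to be monotone, estimates
  on its values are turned into estimates on distances through the power lower bound alone.\<close>

lemma picard_operatorI_powr_contraction:
  fixes \<rho> :: "real \<Rightarrow> real"
  assumes "M \<noteq> {}" and "mcomplete" and "0 \<le> \<alpha>" and "\<alpha> < 1" and "c > 0" and "p > 0"
    and \<rho>0: "continuous (at 0 within {0..}) \<rho>" "\<rho> 0 = 0"
    and \<rho>_ge: "\<And>t. t \<ge> 0 \<Longrightarrow> \<rho> t \<ge> c * t powr p"
    and T: "T \<in> M \<rightarrow> M"
    and contr: "\<And>x y. x \<in> M \<Longrightarrow> y \<in> M \<Longrightarrow> \<rho> (d (T x) (T y)) \<le> \<alpha> * \<rho> (d x y)"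
  shows "picard_operator T"
proof -
  \<comment> \<open>Solving \<open>c * t powr p \<le> B\<close> for \<open>t\<close> takes a
    \<open>p\<close>-th root, which turns the factor \<open>\<alpha> ^ n\<close> into
    \<open>q ^ n\<close>.\<close>
  define q where "q = \<alpha> powr (1 / p)"
  have q: "0 \<le> q" "q < 1"
    using assms powr_less_mono2[of "1 / p" \<alpha> 1] by (auto simp: q_def)
  have iter_M: "(T ^^ n) x \<in> M" if "x \<in> M" for x n
    using that T by (induction n) auto
  have iter_\<rho>: "\<rho> (d ((T ^^ n) x) ((T ^^ n) y)) \<le> \<alpha> ^ n * \<rho> (d x y)"
    if "x \<in> M" "y \<in> M" for x y n
  proof (induction n)
    case (Suc n)
    have "\<rho> (d ((T ^^ Suc n) x) ((T ^^ Suc n) y)) \<le> \<alpha> * \<rho> (d ((T ^^ n) x) ((T ^^ n) y))"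
      using contr iter_M that by simp
    also have "\<dots> \<le> \<alpha> * (\<alpha> ^ n * \<rho> (d x y))"
      using Suc \<open>0 \<le> \<alpha>\<close> by (rule mult_left_mono)
    finally show ?case by (simp add: mult.assoc)
  qed simp
  have d_le: "d x y \<le> (\<rho> (d x y) / c) powr (1 / p)" for x y
    using \<rho>_ge[of "d x y"] \<open>c > 0\<close> \<open>p > 0\<close>
    by (intro le_powr_inverse_if_powr_le) (auto simp: field_simps)
  have \<rho>_nonneg: "\<rho> (d x y) \<ge> 0" for x y
    using \<rho>_ge[of "d x y"] \<open>c > 0\<close> by (smt (verit) nonneg powr_ge_zero mult_nonneg_nonneg)
  have decay: "d ((T ^^ n) x) ((T ^^ n) y) \<le> (\<rho> (d x y) / c) powr (1 / p) * q ^ n"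
    if "x \<in> M" "y \<in> M" for x y n
  proof -
    have "d ((T ^^ n) x) ((T ^^ n) y) \<le> (\<rho> (d ((T ^^ n) x) ((T ^^ n) y)) / c) powr (1 / p)"
      by (rule d_le)
    also have "\<dots> \<le> (\<rho> (d x y) / c * \<alpha> ^ n) powr (1 / p)"
      using iter_\<rho>[OF that, of n] \<rho>_nonneg \<open>c > 0\<close> \<open>p > 0\<close>
      by (intro powr_mono2) (auto simp: field_simps)
    also have "\<dots> = (\<rho> (d x y) / c) powr (1 / p) * q ^ n"
      using \<rho>_nonneg[of x y] \<open>c > 0\<close> \<open>0 \<le> \<alpha>\<close>
      by (simp add: powr_mult power_powr_commute q_def del: times_divide_eq_left)
    finally show ?thesis .
  qed
  have asymptotic: "(\<lambda>n. d ((T ^^ n) x) ((T ^^ n) y)) \<longlonglongrightarrow> 0" if "x \<in> M" "y \<in> M" for x y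
  proof (rule tendsto_sandwich[where f = "\<lambda>_. 0"])
    show "(\<lambda>n. (\<rho> (d x y) / c) powr (1 / p) * q ^ n) \<longlonglongrightarrow> 0"
      using q by (intro tendsto_mult_right_zero LIMSEQ_realpow_zero)
  qed (use decay that in auto)
  obtain x0 where x0: "x0 \<in> M"
    using \<open>M \<noteq> {}\<close> by blast
  define \<sigma> where "\<sigma> n = (T ^^ n) x0" for n
  have \<sigma>_M: "\<sigma> n \<in> M" for n
    using iter_M x0 by (simp add: \<sigma>_def)
  have "MCauchy \<sigma>"
  proof (rule MCauchy_if_geometric_steps)
    \<comment> \<open>Consecutive orbit points are the \<open>n\<close>-th iterates of the pair
      \<open>x0\<close>, \<open>T x0\<close>, so \<open>decay\<close> applies with a constant
      independent of \<open>n\<close>.\<close>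
    show "d (\<sigma> n) (\<sigma> (Suc n)) \<le> (\<rho> (d x0 (T x0)) / c) powr (1 / p) * q ^ n" for n
      using decay[of x0 "T x0" n] x0 T by (auto simp: \<sigma>_def funpow_swap1)
  qed (use \<sigma>_M q in auto)
  then obtain u where lim: "limitin mtopology \<sigma> u sequentially"
    using \<open>mcomplete\<close> by (auto simp: mcomplete_def)
  then have u: "u \<in> M" and \<sigma>_u: "(\<lambda>n. d (\<sigma> n) u) \<longlonglongrightarrow> 0"
    by (auto simp: limitin_metric_dist_null)
  have T_u: "T u \<in> M"
    using u T by auto
  \<comment> \<open>This is where continuity at 0 enters: the distances to \<open>u\<close> approach
    0 within \<open>{0..}\<close>, hence so do their \<open>\<rho>\<close>-values.\<close>
  have \<rho>_u: "(\<lambda>n. \<rho> (d (\<sigma> n) u)) \<longlonglongrightarrow> 0"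
    using continuous_within_tendsto_compose'[OF \<rho>0(1) _ \<sigma>_u] \<rho>0(2) by simp
  \<comment> \<open>Continuity of \<open>T\<close> at \<open>u\<close>, needed only along the orbit:
    one use of the contraction condition, then inversion by \<open>d_le\<close>.\<close>
  have "(\<lambda>n. d (\<sigma> (Suc n)) (T u)) \<longlonglongrightarrow> 0"
  proof (rule tendsto_sandwich[where f = "\<lambda>_. 0"])
    have "d (\<sigma> (Suc n)) (T u) \<le> (\<alpha> * \<rho> (d (\<sigma> n) u) / c) powr (1 / p)" for n
    proof -
      have "d (\<sigma> (Suc n)) (T u) \<le> (\<rho> (d (\<sigma> (Suc n)) (T u)) / c) powr (1 / p)"
        by (rule d_le)
      also have "\<dots> \<le> (\<alpha> * \<rho> (d (\<sigma> n) u) / c) powr (1 / p)"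
        using contr[OF \<sigma>_M[of n] u] \<rho>_nonneg \<open>c > 0\<close> \<open>p > 0\<close>
        by (intro powr_mono2 divide_right_mono) (auto simp: \<sigma>_def)
      finally show ?thesis .
    qed
    then show "\<forall>\<^sub>F n in sequentially. d (\<sigma> (Suc n)) (T u) \<le> (\<alpha> * \<rho> (d (\<sigma> n) u) / c) powr (1 / p)"
      by simp
    have "(\<lambda>n. \<alpha> * \<rho> (d (\<sigma> n) u) / c) \<longlonglongrightarrow> 0"
      using tendsto_divide[OF tendsto_mult[OF tendsto_const \<rho>_u] tendsto_const] \<open>c > 0\<close> by force
    \<comment> \<open>At base limit 0, \<open>powr\<close> passes to the limit because the bases are
      nonnegative and the exponent is positive.\<close>
    then have "(\<lambda>n. (\<alpha> * \<rho> (d (\<sigma> n) u) / c) powr (1 / p)) \<longlonglongrightarrow> 0 powr (1 / p)"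
      using \<rho>_nonneg \<open>0 \<le> \<alpha>\<close> \<open>c > 0\<close> \<open>p > 0\<close> by (intro tendsto_powr') auto
    then show "(\<lambda>n. (\<alpha> * \<rho> (d (\<sigma> n) u) / c) powr (1 / p)) \<longlonglongrightarrow> 0"
      by simp
  qed auto
  then have "limitin mtopology (\<lambda>n. \<sigma> (Suc n)) (T u) sequentially"
    using T_u \<sigma>_M by (simp add: limitin_metric_dist_null)
  moreover have "limitin mtopology (\<lambda>n. \<sigma> (Suc n)) u sequentially"
    using u \<sigma>_M LIMSEQ_Suc[OF \<sigma>_u] by (simp add: limitin_metric_dist_null)
  ultimately have fixed: "T u = u"
    using limitin_metric_unique trivial_limit_sequentially by blast
  have iter_fixed: "(T ^^ n) v = v" if "T v = v" for v n
    using that by (induction n) auto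
  \<comment> \<open>Orbits of fixed points are constant, so \<open>asymptotic\<close> says that the
    constant \<open>d v u\<close> tends to 0.\<close>
  have "v = u" if "v \<in> M" "T v = v" for v
    using asymptotic[of v u] that u fixed by (simp add: iter_fixed LIMSEQ_const_iff)
  moreover have "limitin mtopology (\<lambda>n. (T ^^ n) x) u sequentially" if "x \<in> M" for x
    using asymptotic[of x u] that u fixed iter_M
    by (simp add: iter_fixed limitin_metric_dist_null)
  ultimately show ?thesis
    using T u fixed unfolding picard_operator_def by blast
qed

end

theorem corollary4p7:
  fixes X :: "'a set" and d :: "'a \<Rightarrow> 'a \<Rightarrow> real"
    and T :: "'a \<Rightarrow> 'a"
    and \<psi> :: "real \<Rightarrow> real" and \<alpha> c \<gamma> :: real
  assumes "X \<noteq> {}"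
    and "Metric_space X d"
    and "Metric_space.mcomplete X d"
    and "0 \<le> \<alpha>" and "\<alpha> < 1"
    and "\<psi> \<in> {0..} \<rightarrow> {0..}"
    and "continuous (at 0 within {0..}) \<psi>"
    and "\<psi> 0 = 0"
    and "c > 0" and "\<gamma> > 0"
    and "\<And>t. t \<ge> 0 \<Longrightarrow> \<psi> t \<ge> c * t powr \<gamma>"
    and "T \<in> X \<rightarrow> X"
    and "\<And>x y. x \<in> X \<Longrightarrow> y \<in> X \<Longrightarrow>
           d (T x) (T y) * \<psi> (d (T x) (T y)) \<le> \<alpha> * (d x y * \<psi> (d x y))"
  shows "Metric_space.picard_operator X d T"
proof -
  interpret Metric_space X d by fact
  show ?thesis
  \<comment> \<open>The extra factor \<open>t\<close> raises the exponent of the lower bound from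
    \<open>\<gamma>\<close> to \<open>1 + \<gamma>\<close>.\<close>
  proof (rule picard_operatorI_powr_contraction[where \<rho> = "\<lambda>t. t * \<psi> t" and p = "1 + \<gamma>"])
    show "continuous (at 0 within {0..}) (\<lambda>t. t * \<psi> t)"
      using assms(7) by (intro continuous_intros)
    show "c * t powr (1 + \<gamma>) \<le> t * \<psi> t" if "t \<ge> 0" for t
      using mult_left_mono[OF assms(11)[OF that] that] that
      by (cases "t = 0") (auto simp: powr_add mult_ac)
  qed (use assms in auto)
qed

end
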